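(* Let $\beta$ be a Perron number and $n$ a non-negative integer. (1) If $\beta^n$ is a Parry number, then $n\le \mathrm{Ord}_P(\beta)$. (2) If $\mathrm{Ord}_P(\beta)=n$ and $m$ is a positive integer dividing $n$, then $\mathrm{Ord}_P(\beta^m)=n/m$; in particular $\mathrm{Ord}_P(\beta^n)=1$. (3) If $\mathrm{Ord}_P(\beta)=n$, then for any positive integers $d,k$ with $k>n/d$ we have $\mathrm{Ord}_P(\beta^k)<d$; in particular, for all integers $k>n/2$, $\mathrm{Ord}_P(\beta^k)\in\{0,1\}$.
   Context: A Perron number is a real algebraic integer $\beta>0$ strictly larger in modulus than all its other Galois conjugates (positive powers of Perron numbers are Perron). For real $\beta>1$, $T_\beta(x)=\beta x\bmod1$, and $\beta$ is a Parry number if the orbit $\{T_\beta^k(1)\}_{k\ge1}$ is finite. The Parry order of a Perron number $\beta$ is $\mathrm{Ord}_P(\beta)=\max\{n\in\mathbb N:\beta^n\text{ is a Parry number}\}$ (this set is finite unless $\beta$ is a Pisot or Salem number), with $\mathrm{Ord}_P(\beta)=0$ if no positive power of $\beta$ is Parry and $\mathrm{Ord}_P(\beta)=\infty$ if $\beta$ is a Pisot number (other conjugates in the open unit disc) or Salem number (other conjugates in the closed unit disc, at least one on the unit circle). *)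

theory Defs
  imports Complex_Main "HOL-Computational_Algebra.Computational_Algebra" "HOL-Library.Extended_Nat"
begin

text \<open>
  The complex roots of the minimal polynomial of \<open>x\<close> over the rationals, \<open>x\<close> itself included.
  The set is empty if \<open>x\<close> is transcendental.
\<close>
definition galois_conjugates :: "real \<Rightarrow> complex set" where
  "galois_conjugates x =
     {z. \<exists>p :: rat poly. irreducible p \<and> lead_coeff p = 1 \<and>
          poly (map_poly of_rat p) x = 0 \<and> poly (map_poly of_rat p) z = 0}"

text \<open>With this definition \<open>1\<close> is a Perron number, as it has no other conjugates.\<close>
definition perron_number :: "real \<Rightarrow> bool" where
  "perron_number \<beta> \<longleftrightarrow> algebraic_int \<beta> \<and> \<beta> > 0 \<and>
     (\<forall>z \<in> galois_conjugates \<beta> - {of_real \<beta>}. norm z < \<beta>)"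

definition pisot_number :: "real \<Rightarrow> bool" where
  "pisot_number \<beta> \<longleftrightarrow> algebraic_int \<beta> \<and> \<beta> > 1 \<and>
     (\<forall>z \<in> galois_conjugates \<beta> - {of_real \<beta>}. norm z < 1)"

definition salem_number :: "real \<Rightarrow> bool" where
  "salem_number \<beta> \<longleftrightarrow> algebraic_int \<beta> \<and> \<beta> > 1 \<and>
     (\<forall>z \<in> galois_conjugates \<beta> - {of_real \<beta>}. norm z \<le> 1) \<and>
     (\<exists>z \<in> galois_conjugates \<beta> - {of_real \<beta>}. norm z = 1)"

definition beta_transformation :: "real \<Rightarrow> real \<Rightarrow> real" where
  "beta_transformation \<beta> x = frac (\<beta> * x)"

definition parry_number :: "real \<Rightarrow> bool" where
  "parry_number \<beta> \<longleftrightarrow> \<beta> > 1 \<and> finite {(beta_transformation \<beta> ^^ k) 1 | k. k \<ge> 1}"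

text \<open>
  Whether every power of a Salem number is a Parry number is not known, so the value \<open>\<infinity>\<close> is a
  convention there. For a Perron number that is neither Pisot nor Salem, the set below is finite,
  so that \<^const>\<open>Max\<close> is meaningful.
\<close>
definition parry_order :: "real \<Rightarrow> enat" where
  "parry_order \<beta> =
     (if pisot_number \<beta> \<or> salem_number \<beta> then \<infinity>
      else if \<forall>n > 0. \<not> parry_number (\<beta> ^ n) then 0
      else enat (Max {n :: nat. n > 0 \<and> parry_number (\<beta> ^ n)}))"

end

theory Submission
  imports Defs "HOL-Computational_Algebra.Field_as_Ring"
begin

text \<open>
  The heart of the matter is that the set defining the Parry order is finite unless \<open>\<beta>\<close> is a Pisot
  or Salem number. Let \<open>x\<^sub>k = T\<^sup>k(1)\<close> be the orbit of \<open>1\<close> under the \<open>\<gamma>\<close>-transformation. Then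
  \<open>x\<^sub>k = r\<^sub>k(\<gamma>)\<close> for an integer polynomial \<open>r\<^sub>k\<close>, and for a conjugate \<open>w \<noteq> \<gamma>\<close> the differences
  \<open>\<delta>\<^sub>k = r\<^sub>k(w) - x\<^sub>k\<close> satisfy \<open>\<delta>\<^sub>0 = 0\<close> and \<open>\<delta>\<^sub>k\<^sub>+\<^sub>1 = w \<delta>\<^sub>k + (w - \<gamma>) x\<^sub>k\<close> with \<open>0 \<le> x\<^sub>k \<le> 1\<close>, so they
  are unbounded if \<open>\<bar>w\<bar> > 2\<close>. If \<open>\<gamma>\<close> is a Parry number, there are only finitely many \<open>\<delta>\<^sub>k\<close>; hence all
  conjugates of a Parry number other than itself have modulus at most \<open>2\<close>. If \<open>\<beta>\<close> is neither Pisot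
  nor Salem, some conjugate \<open>z \<noteq> \<beta>\<close> has \<open>\<bar>z\<bar> > 1\<close>, and \<open>\<bar>z\<bar>\<^sup>n \<le> 2\<close> bounds \<open>n\<close> when
  \<open>\<beta>\<^sup>n\<close> is a Parry number.
\<close>

section \<open>Evaluation of rational polynomials\<close>

abbreviation rat_poly_eval :: "rat poly \<Rightarrow> 'a::field_char_0 \<Rightarrow> 'a" where
  "rat_poly_eval p x \<equiv> poly (map_poly of_rat p) x"

lemma rat_poly_eval_pCons:
  "rat_poly_eval (pCons a p) x = of_rat a + x * rat_poly_eval p x"
  by (cases "p = 0 \<and> a = 0") (auto simp: map_poly_pCons)

lemma rat_poly_eval_add: "rat_poly_eval (p + q) x = rat_poly_eval p x + rat_poly_eval q x"
proof (induction p arbitrary: q)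
  case (pCons a p)
  then show ?case
    by (cases q) (simp add: rat_poly_eval_pCons of_rat_add algebra_simps)
qed simp

lemma rat_poly_eval_smult: "rat_poly_eval (smult c p) x = of_rat c * rat_poly_eval p x"
  by (induction p) (simp_all add: rat_poly_eval_pCons of_rat_mult algebra_simps)

lemma rat_poly_eval_diff: "rat_poly_eval (p - q) x = rat_poly_eval p x - rat_poly_eval q x"
  using rat_poly_eval_add[of "p - q" q x] by simp

lemma rat_poly_eval_mult: "rat_poly_eval (p * q) x = rat_poly_eval p x * rat_poly_eval q x"
  by (induction p)
    (simp_all add: rat_poly_eval_pCons rat_poly_eval_add rat_poly_eval_smult algebra_simps)

lemma rat_poly_eval_monom: "rat_poly_eval (monom 1 m) x = x ^ m"
  by (simp add: map_poly_monom poly_monom)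

lemma rat_poly_eval_pcompose:
  "rat_poly_eval (pcompose p q) x = rat_poly_eval p (rat_poly_eval q x)"
  by (induction p)
    (simp_all add: pcompose_pCons rat_poly_eval_pCons rat_poly_eval_add rat_poly_eval_mult)

section \<open>Minimal polynomials and Galois conjugates\<close>

lemma algebraic_int_imp_rat_root:
  assumes "algebraic_int x"
  shows "\<exists>p :: rat poly. p \<noteq> 0 \<and> rat_poly_eval p x = 0"
proof -
  obtain p where p: "poly (map_poly of_int p) x = 0" "lead_coeff p = 1"
    using assms by (auto simp: algebraic_int_altdef_ipoly)
  have "map_poly of_rat (map_poly of_int p :: rat poly) = (map_poly of_int p :: 'a poly)"
    by (subst map_poly_map_poly) (auto simp: o_def)
  moreover have "coeff (map_poly of_int p :: rat poly) (degree p) \<noteq> 0"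
    using p(2) by (simp add: coeff_map_poly)
  hence "(map_poly of_int p :: rat poly) \<noteq> 0" by auto
  ultimately show ?thesis using p(1) by metis
qed

text \<open>A nonzero polynomial of least degree vanishing at \<open>x\<close> is irreducible: in
  any factorization one factor vanishes at \<open>x\<close>, so by minimality the other is constant.
  Scaling makes it monic.\<close>

lemma rat_root_imp_irreducible_rat_root:
  assumes "p \<noteq> 0" "rat_poly_eval p x = 0"
  shows "\<exists>q :: rat poly. irreducible q \<and> lead_coeff q = 1 \<and> rat_poly_eval q x = 0"
proof -
  define P where "P q \<longleftrightarrow> q \<noteq> 0 \<and> rat_poly_eval q x = 0" for q :: "rat poly"
  define q where "q = arg_min degree P"
  have "P p" using assms by (simp add: P_def)
  hence q: "q \<noteq> 0" "rat_poly_eval q x = 0" and min: "\<And>r. P r \<Longrightarrow> degree q \<le> degree r"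
    using arg_min_natI[of P p degree] arg_min_nat_le[of P _ degree] by (auto simp: P_def q_def)
  have unit: "b dvd 1" if "q = a * b" "rat_poly_eval a x = 0" for a b
  proof -
    have nz: "a \<noteq> 0" "b \<noteq> 0" using q that by auto
    hence "degree q \<le> degree a" using that by (intro min) (auto simp: P_def)
    hence "degree b = 0" using nz that by (simp add: degree_mult_eq)
    thus ?thesis using nz by (simp add: is_unit_iff_degree)
  qed
  have "irreducible q"
  proof (rule irreducibleI)
    show "\<not> q dvd 1"
    proof
      assume "q dvd 1"
      then obtain c where "1 = q * c" by blast
      hence "rat_poly_eval 1 x = rat_poly_eval q x * rat_poly_eval c x"
        by (simp flip: rat_poly_eval_mult)
      thus False using q by simp
    qed
    fix a b assume "q = a * b"
    moreover from this have "rat_poly_eval a x = 0 \<or> rat_poly_eval b x = 0"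
      using q by (simp add: rat_poly_eval_mult)
    ultimately show "a dvd 1 \<or> b dvd 1" using unit[of a b] unit[of b a] by (auto simp: mult.commute)
  qed (use q in auto)
  define c where "c = inverse (lead_coeff q)"
  have c: "c \<noteq> 0" using q by (simp add: c_def)
  have "irreducible (smult c q)"
  proof -
    have "smult c q = [:c:] * q" by simp
    moreover have "is_unit [:c:]" using c by (simp add: is_unit_const_poly_iff dvd_field_iff)
    ultimately show ?thesis using \<open>irreducible q\<close> by (metis irreducible_mult_unit_left)
  qed
  moreover have "lead_coeff (smult c q) = 1" using q by (simp add: c_def)
  ultimately show ?thesis using q by (metis rat_poly_eval_smult mult_zero_right)
qed

text \<open>An irreducible \<open>p\<close> not dividing \<open>q\<close> would be coprime to it,
  and a Bezout identity evaluated at the common root \<open>x\<close> would read 0 = 1. So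
  \<open>p\<close> divides \<open>q\<close>, and roots of \<open>p\<close> are roots of
  \<open>q\<close>.\<close>

lemma galois_conjugate_root:
  fixes q :: "rat poly"
  assumes "z \<in> galois_conjugates x" "rat_poly_eval q x = 0"
  shows "rat_poly_eval q z = 0"
proof -
  obtain p :: "rat poly" where p: "irreducible p" "rat_poly_eval p x = 0" "rat_poly_eval p z = 0"
    using assms(1) by (auto simp: galois_conjugates_def)
  have "p dvd q"
  proof (rule ccontr)
    assume "\<not> p dvd q"
    hence "coprime p q" using p(1)
      by (intro prime_elem_imp_coprime irreducible_imp_prime_elem_gcd)
    then obtain a b where "a * p + b * q = 1"
      using bezout_coefficients_fst_snd[of p q] by (metis coprime_iff_gcd_eq_1)
    hence "rat_poly_eval (a * p + b * q) x = 1" by simp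
    thus False using p assms(2) by (simp add: rat_poly_eval_add rat_poly_eval_mult)
  qed
  thus ?thesis using p(3) by (auto simp: rat_poly_eval_mult)
qed

lemma galois_conjugate_power_root:
  fixes q :: "rat poly"
  assumes "z \<in> galois_conjugates x" "rat_poly_eval q (x ^ m) = 0"
  shows "rat_poly_eval q (z ^ m) = 0"
  using galois_conjugate_root[OF assms(1), of "pcompose q (monom 1 m)"] assms(2)
  by (simp add: rat_poly_eval_pcompose rat_poly_eval_monom)

text \<open>The minimal polynomial of \<open>x ^ m\<close> also vanishes at \<open>z ^ m\<close>;
  integrality of \<open>x ^ m\<close> provides this polynomial.\<close>

lemma galois_conjugates_power:
  assumes "algebraic_int (x ^ m)" "z \<in> galois_conjugates x"
  shows "z ^ m \<in> galois_conjugates (x ^ m)"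
proof -
  obtain q :: "rat poly" where q: "irreducible q" "lead_coeff q = 1" "rat_poly_eval q (x ^ m) = 0"
    using algebraic_int_imp_rat_root[OF assms(1)] rat_root_imp_irreducible_rat_root by blast
  with galois_conjugate_power_root[OF assms(2) q(3)] show ?thesis
    by (auto simp: galois_conjugates_def)
qed

section \<open>The orbit of 1 and the conjugates of a Parry number\<close>

primrec orbit_poly :: "real \<Rightarrow> nat \<Rightarrow> rat poly" where
  "orbit_poly \<gamma> 0 = 1"
| "orbit_poly \<gamma> (Suc k) =
     pCons (- of_int \<lfloor>\<gamma> * (beta_transformation \<gamma> ^^ k) 1\<rfloor>) (orbit_poly \<gamma> k)"

text \<open>Each \<open>pCons\<close> multiplies by the base and subtracts the integer digit that
  the real orbit prescribes. Evaluating at a conjugate keeps these digits and changes only the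
  base.\<close>

lemma orbit_poly_eval: "rat_poly_eval (orbit_poly \<gamma> k) \<gamma> = (beta_transformation \<gamma> ^^ k) 1"
proof (induction k)
  case (Suc k)
  have "(beta_transformation \<gamma> ^^ Suc k) 1 = frac (\<gamma> * (beta_transformation \<gamma> ^^ k) 1)"
    unfolding funpow.simps o_apply beta_transformation_def ..
  then show ?case using Suc by (simp add: rat_poly_eval_pCons of_rat_minus frac_def)
qed simp

lemma orbit_bounds:
  "0 \<le> (beta_transformation \<gamma> ^^ k) 1 \<and> (beta_transformation \<gamma> ^^ k) 1 \<le> 1"
  by (cases k) (auto simp: beta_transformation_def less_imp_le[OF frac_lt_1])

lemma parry_conjugate_norm_le_2:
  fixes w :: complex
  assumes "parry_number \<gamma>" and "w \<noteq> of_real \<gamma>"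
    and conj: "\<And>q :: rat poly. rat_poly_eval q \<gamma> = 0 \<Longrightarrow> rat_poly_eval q w = 0"
  shows "norm w \<le> 2"
proof (rule ccontr)
  assume "\<not> norm w \<le> 2"
  define e where "e = norm w - 2"
  have e: "e > 0" "norm w = 2 + e" using \<open>\<not> norm w \<le> 2\<close> by (simp_all add: e_def)
  define x where "x k = (beta_transformation \<gamma> ^^ k) 1" for k
  define y where "y k = rat_poly_eval (orbit_poly \<gamma> k) w" for k
  \<comment> \<open>Dividing by the distance from \<open>w\<close> to \<open>\<gamma>\<close>
    normalises the recursion: \<open>u 1 = 1\<close>, and the inhomogeneous term has size at most
    1.\<close>
  define u where "u k = norm (y k - of_real (x k)) / norm (w - of_real \<gamma>)" for k
  have N: "norm (w - of_real \<gamma>) > 0" using assms(2) by simp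
  \<comment> \<open>Equal orbit values make the difference of the two orbit polynomials vanish at
    \<open>\<gamma>\<close>, hence at \<open>w\<close>.\<close>
  have y_eq: "y i = y j" if "x i = x j" for i j
    using conj[of "orbit_poly \<gamma> i - orbit_poly \<gamma> j"] that
    by (simp add: x_def y_def rat_poly_eval_diff orbit_poly_eval)
  have u_eq: "u i = u j" if "x i = x j" for i j
    unfolding u_def by (simp only: that y_eq[OF that])
  have "range x \<subseteq> insert 1 {(beta_transformation \<gamma> ^^ k) 1 | k. k \<ge> 1}"
  proof (rule image_subsetI)
    fix k show "x k \<in> insert 1 {(beta_transformation \<gamma> ^^ k) 1 | k. k \<ge> 1}"
      by (cases k) (auto simp: x_def simp del: funpow.simps)
  qed
  hence "finite (range x)"
    by (rule finite_subset) (use assms(1) in \<open>auto simp: parry_number_def\<close>)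
  \<comment> \<open>So \<open>u\<close> factors through \<open>x\<close>; choosing an index for each
    orbit value exhibits the finite set.\<close>
  moreover have "range u \<subseteq> (\<lambda>v. u (SOME i. x i = v)) ` range x"
  proof safe
    fix k
    have "x (SOME i. x i = x k) = x k" by (rule someI) auto
    hence "u k = u (SOME i. x i = x k)" by (intro u_eq) simp
    thus "u k \<in> (\<lambda>v. u (SOME i. x i = v)) ` range x" by blast
  qed
  ultimately have "finite (range u)" by (meson finite_surj)
  then obtain B where B: "u k \<le> B" for k
    using bdd_above_finite[of "range u"] by (auto simp: bdd_above_def)
  have rec: "u (Suc k) \<ge> norm w * u k - 1" for k
  proof -
    have "y (Suc k) - of_real (x (Suc k)) = w * y k - of_real \<gamma> * of_real (x k)"
      by (simp add: x_def y_def rat_poly_eval_pCons of_rat_minus beta_transformation_def frac_def)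
    also have "\<dots> = w * (y k - of_real (x k)) + (w - of_real \<gamma>) * of_real (x k)"
      by (simp add: algebra_simps)
    finally have "norm (y (Suc k) - of_real (x (Suc k)))
        \<ge> norm w * norm (y k - of_real (x k)) - norm (w - of_real \<gamma>) * \<bar>x k\<bar>"
      by (metis norm_diff_ineq norm_mult norm_of_real)
    moreover have "norm (w - of_real \<gamma>) * \<bar>x k\<bar> \<le> norm (w - of_real \<gamma>)"
      using orbit_bounds[of k \<gamma>] by (simp add: x_def mult_left_le)
    ultimately have "norm w * norm (y k - of_real (x k)) - norm (w - of_real \<gamma>)
        \<le> norm (y (Suc k) - of_real (x (Suc k)))" by linarith
    thus ?thesis using N by (simp add: u_def field_simps)
  qed
  have "u 1 = 1"
  proof -
    have "y 1 - of_real (x 1) = w - of_real \<gamma>"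
      by (simp add: x_def y_def rat_poly_eval_pCons of_rat_minus beta_transformation_def frac_def)
    thus ?thesis using N by (simp add: u_def)
  qed
  \<comment> \<open>If \<open>u \<ge> 1\<close>, then (2 + e) u - 1 \<ge> u + e. The induction
    starts at index 1 because \<open>u 0\<close> is 0.\<close>
  have grow: "u (Suc k) \<ge> 1 + real k * e" for k
  proof (induction k)
    case 0
    then show ?case using \<open>u 1 = 1\<close> by simp
  next
    case (Suc k)
    have "0 \<le> real k * e" using e by simp
    hence "1 \<le> u (Suc k)" using Suc by linarith
    hence "1 * (1 + e) \<le> u (Suc k) * (1 + e)" using e by (intro mult_right_mono) auto
    with rec[of "Suc k"] Suc show ?case by (simp add: e(2) algebra_simps)
  qed
  obtain k :: nat where "real k * e > B" using e(1) reals_Archimedean3 by blast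
  with grow[of k] B[of "Suc k"] show False by linarith
qed

section \<open>Conjugates outside the unit disc and finiteness of the Parry powers\<close>

lemma perron_conjugate_norm_gt_1:
  assumes "perron_number \<beta>" "\<beta> > 1" "\<not> pisot_number \<beta>" "\<not> salem_number \<beta>"
  shows "\<exists>z \<in> galois_conjugates \<beta>. 1 < norm z \<and> norm z < \<beta>"
proof (rule ccontr)
  assume neg: "\<not> ?thesis"
  have "norm z \<le> 1" if "z \<in> galois_conjugates \<beta> - {of_real \<beta>}" for z
    using neg that assms(1) by (force simp: perron_number_def)
  with assms show False
    by (fastforce simp: perron_number_def pisot_number_def salem_number_def)
qed

text \<open>This keeps the power of a smaller conjugate among the conjugates other than
  \<open>\<beta> ^ n\<close> itself; comparing moduli suffices.\<close>

lemma conjugate_power_neq: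
  fixes z :: complex and \<beta> :: real
  assumes "norm z < \<beta>" "n > 0"
  shows "z ^ n \<noteq> of_real (\<beta> ^ n)"
proof
  assume "z ^ n = of_real (\<beta> ^ n)"
  hence "norm z ^ n = \<bar>\<beta>\<bar> ^ n" by (metis norm_power norm_of_real power_abs)
  moreover have "norm z ^ n < \<bar>\<beta>\<bar> ^ n" using assms by (intro power_strict_mono) auto
  ultimately show False by simp
qed

lemma parry_power_imp_gt_1:
  assumes "parry_number (\<beta> ^ n)" "\<beta> > 0"
  shows "\<beta> > 1" "n > 0"
proof -
  have "\<beta> ^ n > 1" using assms by (simp add: parry_number_def)
  thus "\<beta> > 1" "n > 0"
    using power_le_one[of \<beta> n] assms(2) by (force, cases n) auto
qed

lemma finite_parry_powers:
  assumes "perron_number \<beta>" "\<not> pisot_number \<beta>" "\<not> salem_number \<beta>"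
  shows "finite {n :: nat. n > 0 \<and> parry_number (\<beta> ^ n)}"
proof (cases "\<beta> > 1")
  case False
  with assms(1) have "{n :: nat. n > 0 \<and> parry_number (\<beta> ^ n)} = {}"
    using parry_power_imp_gt_1 by (auto simp: perron_number_def)
  thus ?thesis by (metis finite.emptyI)
next
  case True
  then obtain z where z: "z \<in> galois_conjugates \<beta>" "1 < norm z" "norm z < \<beta>"
    using perron_conjugate_norm_gt_1 assms by blast
  obtain N where N: "2 < norm z ^ N" using z(2) real_arch_pow by blast
  have "n < N" if "n > 0" "parry_number (\<beta> ^ n)" for n
  proof (rule ccontr)
    assume "\<not> n < N"
    hence "norm z ^ N \<le> norm z ^ n" using z(2) by (intro power_increasing) auto
    moreover have "norm (z ^ n) \<le> 2"
      using parry_conjugate_norm_le_2[OF that(2) conjugate_power_neq[OF z(3) that(1)]]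
        galois_conjugate_power_root[OF z(1)] by blast
    ultimately show False using N by (simp add: norm_power)
  qed
  hence "{n :: nat. n > 0 \<and> parry_number (\<beta> ^ n)} \<subseteq> {..<N}" by auto
  thus ?thesis by (rule finite_subset) simp
qed

text \<open>Otherwise \<open>\<beta>\<close> has a conjugate \<open>z\<close> with 1 < |z| <
  \<beta>, and \<open>z ^ m\<close> is a conjugate of \<open>\<beta> ^ m\<close>, different from it,
  of modulus above 1. Hence a finite order of \<open>\<beta>\<close> forces finite orders of its
  positive powers.\<close>

lemma pisot_or_salem_of_power:
  assumes "perron_number \<beta>" "m > 0" "pisot_number (\<beta> ^ m) \<or> salem_number (\<beta> ^ m)"
  shows "pisot_number \<beta> \<or> salem_number \<beta>"
proof (rule ccontr)
  assume neither: "\<not> ?thesis"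
  have pow: "algebraic_int (\<beta> ^ m)" "\<beta> ^ m > 1"
    "\<forall>z \<in> galois_conjugates (\<beta> ^ m) - {of_real (\<beta> ^ m)}. norm z \<le> 1"
    using assms(3) by (force simp: pisot_number_def salem_number_def)+
  have "\<beta> > 1"
    using power_le_one[of \<beta> m] pow(2) assms(1) by (force simp: perron_number_def)
  then obtain z where z: "z \<in> galois_conjugates \<beta>" "1 < norm z" "norm z < \<beta>"
    using perron_conjugate_norm_gt_1 assms(1) neither by blast
  have "norm (z ^ m) \<le> 1"
    using galois_conjugates_power[OF pow(1) z(1)] conjugate_power_neq[OF z(3) assms(2)] pow(3)
    by blast
  moreover have "1 < norm z ^ m" using z(2) assms(2) by (simp add: one_less_power)
  ultimately show False by (simp add: norm_power)
qed

section \<open>Parry orders of powers\<close>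

lemma parry_order_eq_enat_iff:
  assumes "\<not> pisot_number \<beta>" "\<not> salem_number \<beta>"
    and fin: "finite {n :: nat. n > 0 \<and> parry_number (\<beta> ^ n)}"
  shows "parry_order \<beta> = enat n \<longleftrightarrow>
    (\<forall>k > 0. parry_number (\<beta> ^ k) \<longrightarrow> k \<le> n) \<and> (n > 0 \<longrightarrow> parry_number (\<beta> ^ n))"
proof (cases "\<forall>k > 0. \<not> parry_number (\<beta> ^ k)")
  \<comment> \<open>Here the order takes its default value 0, which the guard \<open>n > 0\<close>
    on the right-hand side accommodates.\<close>
  case True
  then show ?thesis using assms by (auto simp: parry_order_def zero_enat_def)
next
  case False
  hence ne: "{n :: nat. n > 0 \<and> parry_number (\<beta> ^ n)} \<noteq> {}" by auto
  show ?thesis using assms(1,2) False Max_eq_iff[OF fin ne, of n]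
    by (auto simp: parry_order_def)
qed

lemma parry_le_parry_order:
  assumes "perron_number \<beta>" "parry_number (\<beta> ^ n)"
  shows "enat n \<le> parry_order \<beta>"
proof (cases "parry_order \<beta>")
  case (enat N)
  hence "\<not> pisot_number \<beta>" "\<not> salem_number \<beta>" by (auto simp: parry_order_def)
  with enat finite_parry_powers[OF assms(1)] parry_order_eq_enat_iff[of \<beta> N] assms
    parry_power_imp_gt_1(2)[of \<beta> n]
  show ?thesis by (auto simp: perron_number_def)
qed simp

lemma parry_order_power_eq_enat_iff:
  assumes "perron_number \<beta>" "parry_order \<beta> = enat n" "m > 0"
  shows "parry_order (\<beta> ^ m) = enat k \<longleftrightarrow>
    (\<forall>j > 0. parry_number (\<beta> ^ (m * j)) \<longrightarrow> j \<le> k) \<and> (k > 0 \<longrightarrow> parry_number (\<beta> ^ (m * k)))"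
proof -
  have np: "\<not> pisot_number \<beta>" "\<not> salem_number \<beta>" using assms(2) by (auto simp: parry_order_def)
  hence np': "\<not> pisot_number (\<beta> ^ m)" "\<not> salem_number (\<beta> ^ m)"
    using pisot_or_salem_of_power assms by blast+
  \<comment> \<open>The relevant exponents for \<open>\<beta> ^ m\<close> form the preimage, under
    the injection \<open>j \<mapsto> m * j\<close>, of the finite set belonging to
    \<open>\<beta>\<close>.\<close>
  have "finite ((\<lambda>j. m * j) -` {n :: nat. n > 0 \<and> parry_number (\<beta> ^ n)})"
    using assms(3) by (intro finite_vimageI finite_parry_powers assms(1) np) (auto simp: inj_def)
  hence "finite {j :: nat. j > 0 \<and> parry_number ((\<beta> ^ m) ^ j)}"
    by (rule finite_subset[rotated]) (auto simp: power_mult assms(3))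
  from parry_order_eq_enat_iff[OF np' this, of k] show ?thesis by (simp add: power_mult)
qed

lemma parry_order_power_dvd:
  assumes "perron_number \<beta>" "parry_order \<beta> = enat n" "m > 0" "m dvd n"
  shows "parry_order (\<beta> ^ m) = enat (n div m)"
proof -
  have "parry_number (\<beta> ^ n)" if "n > 0"
    using that parry_order_power_eq_enat_iff[OF assms(1,2), of 1 n] assms(2) by simp
  moreover have "j \<le> n div m" if "parry_number (\<beta> ^ (m * j))" for j
    using parry_le_parry_order[OF assms(1) that] assms(2,3)
    by (simp add: less_eq_div_iff_mult_less_eq mult.commute)
  ultimately show ?thesis
    using assms(3,4) unfolding parry_order_power_eq_enat_iff[OF assms(1-3)]
    by (auto simp: div_greater_zero_iff)
qed

text \<open>An order \<open>e \<ge> d\<close> of \<open>\<beta> ^ k\<close> would make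
  \<open>\<beta> ^ (k * e)\<close> a Parry number with k e \<ge> k d > n.\<close>

lemma parry_order_power_less:
  assumes "perron_number \<beta>" "parry_order \<beta> = enat n" "k > 0" "d > 0" "n < k * d"
  shows "parry_order (\<beta> ^ k) < enat d"
proof (cases "parry_order (\<beta> ^ k)")
  case (enat e)
  have "e < d"
  proof (rule ccontr)
    assume "\<not> e < d"
    hence "parry_number (\<beta> ^ (k * e))"
      using enat parry_order_power_eq_enat_iff[OF assms(1-3), of e] assms(4) by auto
    hence "k * e \<le> n" using parry_le_parry_order[OF assms(1)] assms(2) by fastforce
    moreover have "k * d \<le> k * e" using \<open>\<not> e < d\<close> by simp
    ultimately show False using assms(5) by linarith
  qed
  thus ?thesis using enat by simp
next
  case infinity
  hence "pisot_number (\<beta> ^ k) \<or> salem_number (\<beta> ^ k)"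
    by (auto simp: parry_order_def zero_enat_def split: if_splits)
  hence "parry_order \<beta> = \<infinity>"
    using pisot_or_salem_of_power[OF assms(1,3)] by (simp add: parry_order_def)
  thus ?thesis using assms(2) by simp
qed

theorem theorem2p7:
  fixes \<beta> :: real and n :: nat
  assumes "perron_number \<beta>"
  shows "(parry_number (\<beta> ^ n) \<longrightarrow> enat n \<le> parry_order \<beta>) \<and>
         (parry_order \<beta> = enat n \<longrightarrow>
            (\<forall>m :: nat. m > 0 \<and> m dvd n \<longrightarrow> parry_order (\<beta> ^ m) = enat (n div m)) \<and>
            (n > 0 \<longrightarrow> parry_order (\<beta> ^ n) = 1)) \<and>
         (parry_order \<beta> = enat n \<longrightarrow>
            (\<forall>d k :: nat. d > 0 \<and> k > 0 \<and> real k > real n / real d \<longrightarrow>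
               parry_order (\<beta> ^ k) < enat d) \<and>
            (\<forall>k :: nat. real k > real n / 2 \<longrightarrow> parry_order (\<beta> ^ k) \<in> {0, 1}))"
proof -
  have less: "parry_order (\<beta> ^ k) < enat d"
    if "parry_order \<beta> = enat n" "d > 0" "k > 0" "real k > real n / real d" for d k :: nat
  proof -
    have "real n < real (k * d)" using that by (simp add: field_simps)
    hence "n < k * d" by (simp only: of_nat_less_iff)
    thus ?thesis using parry_order_power_less assms that by blast
  qed
  have "parry_order (\<beta> ^ k) \<in> {0, 1}"
    if "parry_order \<beta> = enat n" "real k > real n / 2" for k :: nat
  proof -
    have "k > 0" using that(2) by (cases k) auto
    \<comment> \<open>The case d = 2: the only extended naturals below 2 are 0 and 1.\<close>
    hence "parry_order (\<beta> ^ k) < enat 2" using less[of 2 k] that by simp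
    thus ?thesis by (cases "parry_order (\<beta> ^ k)") (auto simp: zero_enat_def one_enat_def)
  qed
  moreover have "parry_order (\<beta> ^ n) = 1" if "parry_order \<beta> = enat n" "n > 0"
    using parry_order_power_dvd[OF assms that(1,2)] that(2) by (simp add: one_enat_def)
  ultimately show ?thesis
    using parry_le_parry_order[OF assms] parry_order_power_dvd[OF assms] less by blast
qed

end
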